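(* Let $p>3$ be a prime. Then $$\sum_{k=0}^{p-1}\frac{\binom{2k}k\binom{4k}{2k}}{64^k(2k+1)}\equiv (-1)^{\frac{p-1}2}-3p^2E_{p-3}\pmod{p^3}.$$
   Context: For $x,y\in\mathbb Q$ with denominators prime to $p$, $x\equiv y\pmod{p^m}$ means $(x-y)/p^m$ has denominator prime to $p$. The Euler numbers are defined by $E_0=1$, $E_n=-\sum_{k=1}^{[n/2]}\binom n{2k}E_{n-2k}$ for $n\ge1$. *)

theory Defs
  imports Complex_Main "HOL-Computational_Algebra.Primes"
begin

definition p_integral :: "nat \<Rightarrow> rat \<Rightarrow> bool" where
  "p_integral p x \<longleftrightarrow> coprime (snd (quotient_of x)) (int p)"

text \<open>The congruence is only meaningful between rationals with denominators prime to \<open>p\<close>,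
  so this requirement on both sides is part of the relation.\<close>

definition rat_cong :: "nat \<Rightarrow> nat \<Rightarrow> rat \<Rightarrow> rat \<Rightarrow> bool" where
  "rat_cong p m x y \<longleftrightarrow>
     p_integral p x \<and> p_integral p y \<and> p_integral p ((x - y) / of_nat p ^ m)"

fun euler_number :: "nat \<Rightarrow> int" where
  "euler_number n =
     (if n = 0 then 1
      else - (\<Sum>k = 1..n div 2. int (n choose (2 * k)) * euler_number (n - 2 * k)))"

declare euler_number.simps [simp del]

end

theory Submission
  imports Defs "HOL-Number_Theory.Residues"
begin

text \<open>
  The summand is \<open>C(a,k) C(-1-a,k) / (2k+1)\<close> at \<open>a = -1/4\<close>, a polynomial in \<open>z = a(a+1)\<close>, so
  modulo \<open>p\<^sup>3\<close> the sum \<open>F(z)\<close> only depends on \<open>z\<close> modulo \<open>p\<^sup>5\<close>, and \<open>a\<close> may be replaced by the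
  natural number \<open>m = (p\<^sup>5 - 2 + \<epsilon>) / 4\<close>, where \<open>\<epsilon>\<close> is 1 or -1 and congruent to \<open>p\<close> modulo 4: then
  \<open>m(m+1)\<close> is congruent to \<open>-3/16\<close>. A telescoping recurrence in \<open>a\<close> gives
  \<open>(2m+1) F(m(m+1)) = 1 + 2 W(1) + \<dots> + 2 W(m)\<close>, where \<open>W(b)\<close> is the product of \<open>1 - b\<^sup>2/j\<^sup>2\<close> over
  \<open>0 < j < p\<close>. Modulo \<open>p\<^sup>3\<close>, \<open>W(pr)\<close> is 1 and \<open>W(pr+i)\<close> is \<open>p\<^sup>2 r(r+1)/i\<^sup>2\<close> for \<open>0 < i < p\<close>. Since the
  sum of \<open>1/i\<^sup>2\<close> over \<open>0 < i < p\<close> vanishes modulo \<open>p\<close>, only the multiples of \<open>p\<close> and the last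
  incomplete block \<open>0 < i \<le> p/4\<close> contribute, and the sum of \<open>1/i\<^sup>2\<close> over the latter is congruent to
  \<open>4\<epsilon>\<close> times the Euler number of index \<open>p-3\<close> modulo \<open>p\<close>.
\<close>

section \<open>The localization of the integers at a prime\<close>

locale rat_localization =
  fixes p :: nat
  assumes prime_p: "prime p"
begin

text \<open>The denominator in lowest terms divides the denominator of any other representation, so
  a single representation with denominator prime to \<open>p\<close> suffices. The closure lemmas
  can then work with unreduced fractions.\<close>

lemma p_integral_iff:
  "p_integral p x \<longleftrightarrow> (\<exists>a b. x = of_int a / of_int b \<and> coprime b (int p))"
proof
  assume "p_integral p x"
  then show "\<exists>a b. x = of_int a / of_int b \<and> coprime b (int p)"
    unfolding p_integral_def
    by (metis prod.collapse quotient_of_div)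
next
  assume "\<exists>a b. x = of_int a / of_int b \<and> coprime b (int p)"
  then obtain a b where x: "x = of_int a / of_int b" and co: "coprime b (int p)" by blast
  obtain c d where q: "quotient_of x = (c, d)" by fastforce
  have d: "d > 0" "coprime c d" "x = of_int c / of_int d"
    using q quotient_of_denom_pos quotient_of_coprime quotient_of_div by auto
  have "b \<noteq> 0"
    using co prime_p by (auto simp: prime_gt_1_nat)
  then have "(of_int (c * b) :: rat) = of_int (a * d)"
    using x d by (simp add: field_simps)
  then have "c * b = a * d"
    using of_int_eq_iff by blast
  then have "d dvd b"
    using d(2) by (metis coprime_commute coprime_dvd_mult_right_iff dvd_triv_right)
  then show "p_integral p x"
    unfolding p_integral_def q using co by (simp add: coprime_divisors[of d b "int p" "int p"])
qed

lemma p_integral_of_int [simp]: "p_integral p (of_int a)"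
  unfolding p_integral_iff by (rule exI[of _ a], rule exI[of _ 1]) auto

lemma p_integral_of_nat [simp]: "p_integral p (of_nat a)"
  using p_integral_of_int[of "int a"] by simp

lemma p_integral_0 [simp]: "p_integral p 0"
  using p_integral_of_int[of 0] by simp

lemma p_integral_1 [simp]: "p_integral p 1"
  using p_integral_of_int[of 1] by simp

lemma p_integral_numeral [simp]: "p_integral p (numeral n)"
  using p_integral_of_int[of "numeral n"] by simp

lemma p_integral_mult [intro]: "p_integral p x \<Longrightarrow> p_integral p y \<Longrightarrow> p_integral p (x * y)"
proof -
  assume "p_integral p x" "p_integral p y"
  then obtain a b c d where *: "x = of_int a / of_int b" "coprime b (int p)"
      "y = of_int c / of_int d" "coprime d (int p)"
    unfolding p_integral_iff by blast
  then show ?thesis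
    unfolding p_integral_iff by (intro exI[of _ "a * c"] exI[of _ "b * d"]) simp
qed

lemma p_integral_add [intro]:
  assumes "p_integral p x" "p_integral p y"
  shows "p_integral p (x + y)"
proof -
  obtain a b c d where *: "x = of_int a / of_int b" "coprime b (int p)"
      "y = of_int c / of_int d" "coprime d (int p)"
    using assms unfolding p_integral_iff by blast
  then have "b \<noteq> 0" "d \<noteq> 0"
    using prime_p by (auto simp: prime_gt_1_nat)
  then have "x + y = of_int (a * d + c * b) / of_int (b * d)"
    using * by (simp add: field_simps)
  then show ?thesis
    unfolding p_integral_iff using *
    by (intro exI[of _ "a * d + c * b"] exI[of _ "b * d"]) simp
qed

lemma p_integral_uminus [intro]: "p_integral p x \<Longrightarrow> p_integral p (- x)"
  using p_integral_mult[OF p_integral_of_int[of "-1"]] by simp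

lemma p_integral_minus_1 [simp]: "p_integral p (- 1)"
  by (rule p_integral_uminus) simp

lemma p_integral_diff [intro]: "p_integral p x \<Longrightarrow> p_integral p y \<Longrightarrow> p_integral p (x - y)"
  using p_integral_add[OF _ p_integral_uminus, of x y] by simp

lemma p_integral_power [intro]: "p_integral p x \<Longrightarrow> p_integral p (x ^ n)"
  by (induction n) auto

lemma p_integral_sum [intro]: "(\<And>i. i \<in> S \<Longrightarrow> p_integral p (f i)) \<Longrightarrow> p_integral p (sum f S)"
  by (induction S rule: infinite_finite_induct) auto

lemma p_integral_inverse: "\<not> p dvd n \<Longrightarrow> p_integral p (1 / of_nat n)"
  unfolding p_integral_iff
  using prime_p prime_imp_coprime[of p n]
  by (intro exI[of _ 1] exI[of _ "int n"]) (auto simp: coprime_commute)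

lemma p_integral_divide_nat:
  "p_integral p x \<Longrightarrow> \<not> p dvd n \<Longrightarrow> p_integral p (x / of_nat n)"
  using p_integral_mult[OF _ p_integral_inverse, of x n] by simp

text \<open>Only the difference is constrained. Integrality of the two sides is tracked separately,
  since the term of \<open>legendre_sum\<close> with \<open>2 * k + 1 = p\<close> involves a
  division by \<open>p\<close>.\<close>

definition pcong :: "nat \<Rightarrow> rat \<Rightarrow> rat \<Rightarrow> bool" where
  "pcong m x y \<longleftrightarrow> p_integral p ((x - y) / of_nat p ^ m)"

lemma p_nonzero [simp]: "p \<noteq> 0"
  using prime_p by auto

lemma pcong_iff: "pcong m x y \<longleftrightarrow> (\<exists>c. p_integral p c \<and> x = y + of_nat p ^ m * c)"
  unfolding pcong_def
proof
  assume "p_integral p ((x - y) / of_nat p ^ m)"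
  then show "\<exists>c. p_integral p c \<and> x = y + of_nat p ^ m * c"
    by (intro exI[of _ "(x - y) / of_nat p ^ m"]) simp
qed auto

lemma pcong_refl [simp]: "pcong m x x"
  by (simp add: pcong_def)

lemma pcong_sym: "pcong m x y \<Longrightarrow> pcong m y x"
  unfolding pcong_def
  by (drule p_integral_uminus) (simp only: minus_divide_left minus_diff_eq)

lemma pcong_trans [trans]: "pcong m x y \<Longrightarrow> pcong m y z \<Longrightarrow> pcong m x z"
  unfolding pcong_def
  by (drule (1) p_integral_add) (simp flip: add_divide_distrib)

lemma pcong_add: "pcong m x y \<Longrightarrow> pcong m x' y' \<Longrightarrow> pcong m (x + x') (y + y')"
  unfolding pcong_def
  by (drule (1) p_integral_add) (simp add: add_diff_add flip: add_divide_distrib)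

lemma pcong_cmult: "pcong m x y \<Longrightarrow> p_integral p c \<Longrightarrow> pcong m (c * x) (c * y)"
  unfolding pcong_def
  by (drule p_integral_mult, assumption) (simp add: algebra_simps)

text \<open>One factor is exchanged at a time, passing through \<open>y * x'\<close>; the factor
  held fixed in each exchange must be integral.\<close>

lemma pcong_mult:
  assumes "pcong m x y" "pcong m x' y'" "p_integral p x'" "p_integral p y"
  shows "pcong m (x * x') (y * y')"
proof -
  have "pcong m (x' * x) (x' * y)" "pcong m (y * x') (y * y')"
    using assms pcong_cmult by blast+
  then show ?thesis
    using pcong_trans by (simp add: mult.commute)
qed

lemma pcong_sum: "(\<And>i. i \<in> S \<Longrightarrow> pcong m (f i) (g i)) \<Longrightarrow> pcong m (sum f S) (sum g S)"
  by (induction S rule: infinite_finite_induct) (auto intro: pcong_add)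

lemma pcong_shift: "pcong m x y \<Longrightarrow> pcong (k + m) (of_nat p ^ k * x) (of_nat p ^ k * y)"
  by (simp add: pcong_def power_add flip: right_diff_distrib)

lemma pcong_p_integral: "pcong m x y \<Longrightarrow> p_integral p y \<Longrightarrow> p_integral p x"
  unfolding pcong_iff by (auto intro!: p_integral_add p_integral_mult p_integral_power)

lemma pcong_of_int:
  assumes "[a = b] (mod int p)"
  shows "pcong 1 (of_int a) (of_int b)"
proof -
  obtain c where "a = b + int p * c"
    using assms by (metis cong_iff_lin cong_sym)
  then show ?thesis
    unfolding pcong_iff by (intro exI[of _ "of_int c"]) auto
qed

lemmas p_integral_intros = p_integral_add p_integral_mult p_integral_diff p_integral_uminus
  p_integral_power p_integral_sum p_integral_divide_nat

lemma not_dvd_less: "0 < i \<Longrightarrow> i < p \<Longrightarrow> \<not> p dvd i"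
  by (rule nat_dvd_not_less)

lemma p_integral_inverse_sq: "\<not> p dvd i \<Longrightarrow> p_integral p (1 / of_nat i ^ 2)"
  using p_integral_power[OF p_integral_inverse, of i 2] by (simp add: power_one_over)

lemma p_integral_divide_numeral:
  assumes "p_integral p x" "p > numeral n"
  shows "p_integral p (x / numeral n)"
  using p_integral_divide_nat[of x "numeral n"] not_dvd_less[of "numeral n"] assms by simp

lemma pcong_iff_0: "pcong m x y \<longleftrightarrow> pcong m (x - y) 0"
  by (simp add: pcong_def)

lemma pcong_divide_nat:
  assumes "pcong 1 x y" "p_integral p y" "[m = n] (mod p)" "\<not> p dvd n"
  shows "pcong 1 (x / of_nat m) (y / of_nat n)"
proof -
  have m: "\<not> p dvd m" using assms cong_dvd_iff by blast
  then have nz: "m \<noteq> 0" "n \<noteq> 0" using assms by (auto intro: Nat.gr0I)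
  have "pcong 1 (x / of_nat m) (y / of_nat m)"
    using pcong_cmult[OF assms(1) p_integral_inverse[OF m]] by simp
  also have "pcong 1 (y / of_nat m) (y / of_nat n)"
  proof -
    have "[int n = int m] (mod int p)" using assms by (simp add: cong_int_iff cong_sym)
    then have "pcong 1 (of_nat n) (of_nat m)" using pcong_of_int by fastforce
    \<comment> \<open>Scaling \<open>n\<close> and \<open>m\<close> by \<open>y / (m * n)\<close>
      exchanges the two denominators.\<close>
    then have "pcong 1 (y * (1 / of_nat m) * (1 / of_nat n) * of_nat n) (y * (1 / of_nat m) * (1 / of_nat n) * of_nat m)"
      using m assms by (intro pcong_cmult p_integral_mult p_integral_inverse)
    then show ?thesis using nz by simp
  qed
  finally show ?thesis .
qed

end

section \<open>Euler numbers\<close>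

text \<open>In terms of the Euler polynomial \<open>E_n\<close> this is
  \<open>2^n * E_n((x + 1) / 2)\<close>, a normalisation with integer coefficients.\<close>

definition euler_binomial_sum :: "nat \<Rightarrow> int \<Rightarrow> int" where
  "euler_binomial_sum n x = (\<Sum>k\<le>n. int (n choose k) * euler_number k * x ^ (n - k))"

lemma euler_number_odd: "odd n \<Longrightarrow> euler_number n = 0"
proof (induction n rule: less_induct)
  case (less n)
  have "euler_number (n - 2 * k) = 0" if "k \<in> {1..n div 2}" for k
    using less that by (intro less.IH) auto
  then show ?case
    using less.prems by (subst euler_number.simps) (auto elim: oddE)
qed

text \<open>Coefficient form of the identity \<open>E(t) * (exp t + exp (-t)) = 2\<close> for the
  exponential generating function \<open>E(t)\<close>. The last factor kills odd
  \<open>m - k\<close> and doubles the rest, which leaves the defining recurrence.\<close>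

lemma euler_number_convolution:
  "(\<Sum>k\<le>m. int (m choose k) * euler_number k * (1 + (- 1) ^ (m - k))) = (if m = 0 then 2 else 0)"
proof (cases "m = 0")
  case False
  have "(\<Sum>k\<le>m. int (m choose k) * euler_number k * (1 + (- 1) ^ (m - k)))
      = (\<Sum>k\<le>m. int (m choose k) * euler_number (m - k) * (1 + (- 1) ^ k))"
    by (rule sum.reindex_bij_witness[of _ "\<lambda>k. m - k" "\<lambda>k. m - k"])
      (auto simp: binomial_symmetric[symmetric])
  also have "\<dots> = (\<Sum>k\<in>(\<lambda>i. 2 * i) ` {..m div 2}. int (m choose k) * euler_number (m - k) * (1 + (- 1) ^ k))"
  proof (rule sum.mono_neutral_right)
    show "\<forall>k\<in>{..m} - (\<lambda>i. 2 * i) ` {..m div 2}.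
        int (m choose k) * euler_number (m - k) * (1 + (- 1) ^ k) = 0"
    proof
      fix k assume k: "k \<in> {..m} - (\<lambda>i. 2 * i) ` {..m div 2}"
      have "odd k"
      proof
        assume "even k"
        then have "k = 2 * (k div 2)" "k div 2 \<in> {..m div 2}" using k by (auto simp: div_le_mono)
        with k show False by blast
      qed
      then show "int (m choose k) * euler_number (m - k) * (1 + (- 1) ^ k) = 0" by simp
    qed
  qed auto
  also have "\<dots> = 2 * (\<Sum>i\<le>m div 2. int (m choose (2 * i)) * euler_number (m - 2 * i))"
    by (subst sum.reindex) (auto simp: inj_on_def sum_distrib_left algebra_simps)
  also have "(\<Sum>i\<le>m div 2. int (m choose (2 * i)) * euler_number (m - 2 * i)) = 0"
  proof -
    have "{..m div 2} = insert 0 {1..m div 2}" by auto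
    then show ?thesis
      using False by (simp add: euler_number.simps[of m])
  qed
  finally show ?thesis using False by simp
qed (simp add: euler_number.simps)

text \<open>The classical \<open>E_n(y + 1) + E_n(y) = 2 * y^n\<close> at \<open>y = x / 2\<close>.
  After expanding both powers and interchanging the sums, the coefficient of each \<open>x^j\<close>
  is a convolution that vanishes unless \<open>j = n\<close>.\<close>

lemma euler_binomial_sum_functional:
  "euler_binomial_sum n (x + 1) + euler_binomial_sum n (x - 1) = 2 * x ^ n"
proof -
  have binom: "(x + 1) ^ m + (x - 1) ^ m = (\<Sum>j\<le>m. int (m choose j) * x ^ j * (1 + (- 1) ^ (m - j)))" for m
    using binomial_ring[of x 1 m] binomial_ring[of x "-1" m]
    by (simp add: sum.distrib algebra_simps)
  have "euler_binomial_sum n (x + 1) + euler_binomial_sum n (x - 1)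
      = (\<Sum>k\<le>n. int (n choose k) * euler_number k * ((x + 1) ^ (n - k) + (x - 1) ^ (n - k)))"
    unfolding euler_binomial_sum_def by (simp add: sum.distrib algebra_simps)
  also have "\<dots> = (\<Sum>k\<le>n. \<Sum>j\<le>n - k. int (n choose k) * int ((n - k) choose j)
      * euler_number k * x ^ j * (1 + (- 1) ^ (n - k - j)))"
    unfolding binom by (simp add: sum_distrib_left algebra_simps)
  also have "\<dots> = (\<Sum>j\<le>n. \<Sum>k\<le>n - j. int (n choose k) * int ((n - k) choose j)
      * euler_number k * x ^ j * (1 + (- 1) ^ (n - k - j)))"
    unfolding sum.Sigma[OF finite_atMost ballI[OF finite_atMost]]
    by (rule sum.reindex_bij_witness[of _ prod.swap prod.swap]) auto
  also have "\<dots> = (\<Sum>j\<le>n. int (n choose j) * x ^ j * (\<Sum>k\<le>n - j. int ((n - j) choose k)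
      * euler_number k * (1 + (- 1) ^ (n - j - k))))"
  proof -
    have "(n choose k) * ((n - k) choose j) = (n choose j) * ((n - j) choose k)"
      if "j \<le> n" "k \<le> n - j" for j k
      using that choose_mult[of k "k + j" n] choose_mult[of j "k + j" n]
      by (simp add: binomial_symmetric[of k "k + j"])
    then have "int (n choose k) * int ((n - k) choose j) = int (n choose j) * int ((n - j) choose k)"
      if "j \<le> n" "k \<le> n - j" for j k
      using that by (metis of_nat_mult)
    then show ?thesis
      unfolding sum_distrib_left
      by (intro sum.cong refl) (simp add: diff_commute mult_ac add.commute)
  qed
  also have "\<dots> = (\<Sum>j\<le>n. if j = n then 2 * x ^ n else 0)"
    unfolding euler_number_convolution by (intro sum.cong) auto
  finally show ?thesis by simp
qed

lemma euler_binomial_sum_0: "euler_binomial_sum n 0 = euler_number n"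
proof -
  have "euler_binomial_sum n 0 = (\<Sum>k\<le>n. if k = n then euler_number n else 0)"
    unfolding euler_binomial_sum_def by (intro sum.cong) auto
  then show ?thesis by simp
qed

text \<open>Euler numbers of odd index vanish, so only even powers of \<open>x\<close>
  occur.\<close>

lemma euler_binomial_sum_minus:
  assumes "even n"
  shows "euler_binomial_sum n (- x) = euler_binomial_sum n x"
  unfolding euler_binomial_sum_def
proof (intro sum.cong refl)
  fix k assume "k \<in> {..n}"
  then show "int (n choose k) * euler_number k * (- x) ^ (n - k)
      = int (n choose k) * euler_number k * x ^ (n - k)"
    using assms by (cases "even k") (auto simp: euler_number_odd)
qed

lemma euler_binomial_sum_telescope:
  "(- 1) ^ m * euler_binomial_sum n (2 * int m)
    = euler_number n - 2 * (\<Sum>l<m. (- 1) ^ l * (2 * int l + 1) ^ n)"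
proof (induction m)
  case 0
  then show ?case by (simp add: euler_binomial_sum_0)
next
  case (Suc m)
  have step: "euler_binomial_sum n (2 * int (Suc m))
      = 2 * (2 * int m + 1) ^ n - euler_binomial_sum n (2 * int m)"
    using euler_binomial_sum_functional[of n "2 * int m + 1"] by (simp add: algebra_simps)
  show ?case
    unfolding step using Suc by (simp add: algebra_simps)
qed

lemma euler_binomial_sum_cong:
  "[x = y] (mod m) \<Longrightarrow> [euler_binomial_sum n x = euler_binomial_sum n y] (mod m)"
  unfolding euler_binomial_sum_def by (intro cong_sum cong_mult cong_pow cong_refl)

text \<open>At \<open>x = 0\<close> the functional equation and evenness make the polynomial vanish
  at \<open>-1\<close>, hence modulo \<open>2h + 1\<close> also at \<open>2h\<close>. The telescoped
  form at \<open>2h\<close> then expresses the Euler number by the alternating sum.\<close>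

lemma euler_number_cong_alternating:
  fixes h n :: nat
  assumes "even n" "n > 0"
  shows "[euler_number n = 2 * (\<Sum>l<h. (- 1) ^ l * (2 * int l + 1) ^ n)] (mod (2 * int h + 1))"
proof -
  have "euler_binomial_sum n (- 1) = 0"
    using euler_binomial_sum_functional[of n 0] euler_binomial_sum_minus[of n 1] assms by simp
  then have "[euler_binomial_sum n (2 * int h) = 0] (mod (2 * int h + 1))"
    using euler_binomial_sum_cong[of "2 * int h" "- 1" "2 * int h + 1" n]
    by (simp add: cong_iff_dvd_diff)
  then have "[(- 1) ^ h * euler_binomial_sum n (2 * int h) = (- 1) ^ h * 0] (mod (2 * int h + 1))"
    by (intro cong_mult cong_refl)
  then show ?thesis
    unfolding euler_binomial_sum_telescope by (simp add: cong_iff_dvd_diff)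
qed

section \<open>A telescoping recurrence\<close>

text \<open>A truncation of Euler's product for \<open>sin(pi a) / (pi a)\<close>;
  \<open>W(b)\<close> of the overview is the case \<open>n = p - 1\<close>.\<close>

definition sine_prod :: "nat \<Rightarrow> rat \<Rightarrow> rat" where
  "sine_prod n a = (\<Prod>j = 1..n. (of_nat j ^ 2 - a ^ 2) / of_nat j ^ 2)"

text \<open>For \<open>z = a(a+1)\<close> this is \<open>C(a,k) * C(-1-a,k)\<close>, the coefficient
  of \<open>x^k\<close> in the Legendre function \<open>P_a(1 - 2x)\<close>. Taking \<open>z\<close>
  as the argument makes it visibly a polynomial in \<open>z\<close>.\<close>

definition legendre_coeff :: "rat \<Rightarrow> nat \<Rightarrow> rat" where
  "legendre_coeff z k = (\<Prod>j = 1..k. (of_nat j * (of_nat j - 1) - z) / of_nat j ^ 2)"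

definition legendre_sum :: "nat \<Rightarrow> rat \<Rightarrow> rat" where
  "legendre_sum n z = (\<Sum>k<n. legendre_coeff z k / of_nat (2 * k + 1))"

lemma sine_prod_0 [simp]: "sine_prod n 0 = 1"
  unfolding sine_prod_def by (rule prod.neutral) auto

text \<open>A partial sum of the hypergeometric series \<open>2F1(a, -a; 1; 1)\<close>. The term of
  index \<open>n + 1\<close> is \<open>-a^2 / (n+1)^2\<close> times \<open>sine_prod n a\<close>, so
  adding it multiplies the product by its next factor.\<close>

lemma sum_sine_terms:
  "(\<Sum>k\<le>n. \<Prod>j = 1..k. ((of_nat j - 1) ^ 2 - a ^ 2) / of_nat j ^ 2) = sine_prod n a"
proof -
  have step: "(\<Prod>j = 1..Suc n. ((of_nat j - 1) ^ 2 - a ^ 2) / of_nat j ^ 2)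
      = - (a ^ 2) / of_nat (Suc n) ^ 2 * sine_prod n a" for n
  proof (induction n)
    case 0
    then show ?case by (simp add: sine_prod_def)
  next
    case (Suc n)
    show ?case
      by (subst prod.nat_ivl_Suc', simp, subst Suc)
        (simp add: sine_prod_def field_simps del: of_nat_Suc)
  qed
  show ?thesis
  proof (induction n)
    case (Suc n)
    show ?case
      unfolding sum.atMost_Suc Suc step
      by (simp add: sine_prod_def field_simps del: of_nat_Suc)
  qed (simp add: sine_prod_def)
qed

text \<open>The numerators factor as \<open>(j-1-a)(j+a)\<close> and \<open>(j-1-a)(j-1+a)\<close>,
  so the ratio of the two products telescopes to \<open>(a+k)/a\<close>.\<close>

lemma legendre_coeff_sine_term:
  "a * legendre_coeff (a * (a + 1)) k
    = (\<Prod>j = 1..k. ((of_nat j - 1) ^ 2 - a ^ 2) / of_nat j ^ 2) * (a + of_nat k)"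
proof (induction k)
  case (Suc k)
  let ?V = "\<lambda>k. \<Prod>j = 1..k. ((of_nat j - 1) ^ 2 - a ^ 2) / of_nat j ^ 2"
  have "a * legendre_coeff (a * (a + 1)) (Suc k)
      = a * legendre_coeff (a * (a + 1)) k * ((of_nat (Suc k) * of_nat k - a * (a + 1)) / of_nat (Suc k) ^ 2)"
    by (simp add: legendre_coeff_def)
  also have "\<dots> = ?V k * ((a + of_nat k) * (of_nat (Suc k) * of_nat k - a * (a + 1))) / of_nat (Suc k) ^ 2"
    unfolding Suc by simp
  also have "(a + of_nat k) * (of_nat (Suc k) * of_nat k - a * (a + 1))
      = (of_nat k ^ 2 - a ^ 2) * (a + of_nat (Suc k))"
    by (simp add: power2_eq_square algebra_simps)
  finally show ?case by simp
qed (simp add: legendre_coeff_def)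

text \<open>Since \<open>a(a-1)\<close> belongs to \<open>-a\<close>, both coefficients are
  multiples of the same product. The identity \<open>(2a+1)(a+k) - (2a-1)(a-k) = 2a(2k+1)\<close>
  cancels the denominator \<open>2k+1\<close>, and \<open>sum_sine_terms\<close> sums the
  rest.\<close>

lemma legendre_sum_recurrence:
  assumes "a \<noteq> 0"
  shows "(2 * a + 1) * legendre_sum (Suc n) (a * (a + 1)) - (2 * a - 1) * legendre_sum (Suc n) (a * (a - 1))
    = 2 * sine_prod n a"
proof -
  let ?V = "\<lambda>k. \<Prod>j = 1..k. ((of_nat j - 1) ^ 2 - a ^ 2) / of_nat j ^ 2"
  have step: "(2 * a + 1) * (legendre_coeff (a * (a + 1)) k / of_nat (2 * k + 1))
      - (2 * a - 1) * (legendre_coeff (a * (a - 1)) k / of_nat (2 * k + 1)) = 2 * ?V k" for k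
  proof -
    have pos: "(of_nat (2 * k + 1) :: rat) \<noteq> 0" by (simp only: of_nat_eq_0_iff)
    have "a * (a - 1) = (- a) * (- a + 1)" by (simp add: algebra_simps)
    then have m: "a * legendre_coeff (a * (a - 1)) k = ?V k * (a - of_nat k)"
      using legendre_coeff_sine_term[of "- a" k] by (simp add: algebra_simps)
    have "a * ((2 * a + 1) * legendre_coeff (a * (a + 1)) k - (2 * a - 1) * legendre_coeff (a * (a - 1)) k)
        = (2 * a + 1) * (a * legendre_coeff (a * (a + 1)) k) - (2 * a - 1) * (a * legendre_coeff (a * (a - 1)) k)"
      by (simp add: algebra_simps)
    also have "\<dots> = a * (2 * ?V k * of_nat (2 * k + 1))"
      unfolding m legendre_coeff_sine_term by (simp add: algebra_simps)
    finally have "(2 * a + 1) * legendre_coeff (a * (a + 1)) k - (2 * a - 1) * legendre_coeff (a * (a - 1)) k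
        = 2 * ?V k * of_nat (2 * k + 1)"
      using assms mult_cancel_left by blast
    then show ?thesis
      using pos by (simp only: times_divide_eq_right flip: diff_divide_distrib) simp
  qed
  show ?thesis
    unfolding legendre_sum_def lessThan_Suc_atMost sum_distrib_left sum_subtractf[symmetric] step
      sum_sine_terms[symmetric] ..
qed

lemma legendre_sum_nat:
  "(2 * of_nat m + 1) * legendre_sum (Suc n) (of_nat m * (of_nat m + 1))
    = 2 * (\<Sum>b\<le>m. sine_prod n (of_nat b)) - 1"
proof (induction m)
  case 0
  \<comment> \<open>At \<open>z = 0\<close> the factor \<open>j = 1\<close> vanishes, so only the
    term \<open>k = 0\<close> survives.\<close>
  have "legendre_coeff 0 k = (if k = 0 then 1 else 0)" for k
  proof (cases "k = 0")
    case False
    then have "\<exists>j\<in>{1..k}. (of_nat j * (of_nat j - 1) - 0) / of_nat j ^ 2 = (0::rat)"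
      by (intro bexI[of _ 1]) auto
    then show ?thesis
      using False unfolding legendre_coeff_def by simp
  qed (simp add: legendre_coeff_def)
  then show ?case
    by (simp add: legendre_sum_def if_distrib[of "\<lambda>x. x / _"] cong: if_cong)
next
  case (Suc m)
  have e: "2 * (of_nat (Suc m) :: rat) - 1 = 2 * of_nat m + 1"
    "(of_nat (Suc m) :: rat) * (of_nat (Suc m) - 1) = of_nat m * (of_nat m + 1)"
    by (simp_all add: algebra_simps)
  have "(of_nat (Suc m) :: rat) \<noteq> 0" by (simp only: of_nat_eq_0_iff)
  from legendre_sum_recurrence[OF this, of n] show ?case
    unfolding e Suc sum.atMost_Suc by (simp only: algebra_simps)
qed

text \<open>The factors \<open>j - b\<close> and \<open>j + b\<close> fill up the two binomials
  apart from \<open>b\<close> and \<open>b + n + 1\<close>. With \<open>n + 1 = p\<close> this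
  exposes the factor \<open>p^2\<close> in the product.\<close>

lemma sine_prod_binomial:
  "of_nat b * of_nat (b + n + 1) * sine_prod n (of_nat b)
    = (- 1) ^ n * of_nat (n + 1) ^ 2 * of_nat (b choose (n + 1)) * of_nat ((b + n + 1) choose (n + 1))"
proof (induction n)
  case 0
  then show ?case by (simp add: sine_prod_def)
next
  case (Suc n)
  define N B C C' where "N = (of_nat (Suc n) :: rat)" and "B = (of_nat b :: rat)"
    and "C = (of_nat (b choose (n + 1)) :: rat)" and "C' = (of_nat ((b + n + 1) choose (n + 1)) :: rat)"
  have "N > 0" "B + N > 0" unfolding N_def B_def by (simp_all add: add_nonneg_pos)
  then have nz: "N \<noteq> 0" "B + N \<noteq> 0" "N + 1 \<noteq> 0" by auto
  have c1: "(N + 1) * of_nat (b choose (n + 2)) = (B - N) * C"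
    using gbinomial_mult_1[of B "n + 1"] unfolding N_def B_def C_def
    by (simp add: binomial_gbinomial left_diff_distrib)
  have "Suc (b + n + 1) * ((b + n + 1) choose (n + 1)) = (Suc (b + n + 1) choose Suc (n + 1)) * Suc (n + 1)"
    by (rule Suc_times_binomial_eq)
  then have "(of_nat (Suc (b + n + 1)) * of_nat ((b + n + 1) choose (n + 1)) :: rat)
      = of_nat (Suc (b + n + 1) choose Suc (n + 1)) * of_nat (Suc (n + 1))"
    by (simp only: of_nat_mult[symmetric])
  then have c2: "(N + 1) * of_nat ((b + n + 2) choose (n + 2)) = (B + N + 1) * C'"
    unfolding N_def B_def C'_def by (simp add: algebra_simps)
  have IH: "B * (B + N) * sine_prod n B = (- 1) ^ n * N ^ 2 * C * C'"
    using Suc unfolding B_def N_def C_def C'_def by (simp add: algebra_simps)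
  \<comment> \<open>The extra \<open>B + N\<close> is present because the induction hypothesis
    carries \<open>B * (B + N)\<close>; it is nonzero and is cancelled below.\<close>
  have "(B + N) * (B * (B + N + 1) * sine_prod (Suc n) B)
      = (B * (B + N) * sine_prod n B) * ((B + N + 1) * (N ^ 2 - B ^ 2) / N ^ 2)"
    by (simp add: sine_prod_def N_def B_def)
  also have "\<dots> = (B + N) * ((- 1) ^ Suc n * ((B - N) * C) * ((B + N + 1) * C'))"
    unfolding IH using nz by (simp add: power2_eq_square field_simps)
  finally have "B * (B + N + 1) * sine_prod (Suc n) B = (- 1) ^ Suc n * ((B - N) * C) * ((B + N + 1) * C')"
    using nz(2) mult_cancel_left by blast
  also have "\<dots> = (- 1) ^ Suc n * (N + 1) ^ 2 * of_nat (b choose (n + 2)) * of_nat ((b + n + 2) choose (n + 2))"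
    unfolding c1[symmetric] c2[symmetric] power2_eq_square by (simp only: mult_ac)
  moreover have "Suc n + 1 = n + 2" "b + Suc n + 1 = b + n + 2" by simp_all
  moreover have "of_nat (n + 2) = N + 1" "of_nat (b + n + 2) = B + N + 1"
    by (simp_all add: N_def B_def)
  ultimately show ?case by (simp only: B_def)
qed

section \<open>Identification of the summand at \<open>z = -3/16\<close>\<close>

lemma central_binomial_Suc:
  "of_nat (n + 1) * of_nat ((2 * (n + 1)) choose (n + 1)) = (2 * of_nat (2 * n + 1) * of_nat ((2 * n) choose n) :: rat)"
proof -
  have "Suc n * (Suc (Suc (2 * n)) choose Suc n) = Suc (Suc (2 * n)) * (Suc (2 * n) choose n)"
    by (rule Suc_times_binomial)
  moreover have "Suc (2 * n) choose n = Suc (2 * n) choose Suc n"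
    using binomial_symmetric[of n "Suc (2 * n)"] by simp
  moreover have "Suc n * (Suc (2 * n) choose Suc n) = Suc (2 * n) * ((2 * n) choose n)"
    by (rule Suc_times_binomial)
  ultimately have "Suc n * (Suc (Suc (2 * n)) choose Suc n) = 2 * Suc (2 * n) * ((2 * n) choose n)"
    by (metis (no_types, opaque_lifting) mult.assoc mult_2 mult_Suc_right add_2_eq_Suc)
  then have "(n + 1) * ((2 * (n + 1)) choose (n + 1)) = 2 * (2 * n + 1) * ((2 * n) choose n)"
    by (simp only: Suc_eq_plus1 mult_2) (simp only: add.assoc add.commute add.left_commute)
  then have "(of_nat ((n + 1) * ((2 * (n + 1)) choose (n + 1))) :: rat) = of_nat (2 * (2 * n + 1) * ((2 * n) choose n))"
    by presburger
  then show ?thesis by (simp only: of_nat_mult of_nat_numeral)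
qed

text \<open>Here \<open>-3/16 = a(a+1)\<close> for \<open>a = -1/4\<close>. On both sides the ratio
  of consecutive terms is \<open>(4k+1)(4k+3) / (16 (k+1)^2)\<close>.\<close>

lemma legendre_coeff_central:
  "legendre_coeff (- 3 / 16) k
    = of_nat ((2 * k) choose k) * of_nat ((4 * k) choose (2 * k)) / 64 ^ k"
proof (induction k)
  case (Suc k)
  define K where "K = (of_nat k :: rat)"
  define c where "c n = (of_nat ((2 * n) choose n) :: rat)" for n
  have K: "K \<ge> 0" by (simp add: K_def)
  have c: "of_nat (n + 1) * c (n + 1) = 2 * of_nat (2 * n + 1) * c n" for n
    unfolding c_def by (rule central_binomial_Suc)
  have c1: "c (k + 1) = 2 * (2 * K + 1) / (K + 1) * c k"
    and c2: "c (2 * k + 1) = 2 * (4 * K + 1) / (2 * K + 1) * c (2 * k)"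
    and c3: "c (2 * k + 2) = 2 * (4 * K + 3) / (2 * K + 2) * c (2 * k + 1)"
    using c[of k] c[of "2 * k"] c[of "2 * k + 1"] K
    by (simp_all add: K_def field_simps)
  have "legendre_coeff (- 3 / 16) (Suc k)
      = legendre_coeff (- 3 / 16) k * (((K + 1) * K + 3 / 16) / (K + 1) ^ 2)"
    by (simp add: legendre_coeff_def K_def add.commute)
  also have "legendre_coeff (- 3 / 16) k = c k * c (2 * k) / 64 ^ k"
    unfolding Suc c_def by simp
  also have "\<dots> * (((K + 1) * K + 3 / 16) / (K + 1) ^ 2) = c (k + 1) * c (2 * k + 2) / 64 ^ Suc k"
  proof -
    define D where "D = ((K + 1) * K + 3 / 16) / (K + 1) ^ 2"
    have "c (k + 1) * c (2 * k + 2) = c k * c (2 * k) * (64 * (((K + 1) * K + 3 / 16) / (K + 1) ^ 2))"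
      unfolding c1 c3 c2 using K by (simp add: divide_simps add_nonneg_eq_0_iff) (simp add: power2_eq_square algebra_simps)
    then show ?thesis unfolding D_def[symmetric] by simp
  qed
  finally have "legendre_coeff (- 3 / 16) (Suc k) = c (Suc k) * c (2 * Suc k) / 64 ^ Suc k" by simp
  moreover have "2 * (2 * Suc k) = 4 * Suc k" by simp
  ultimately show ?case unfolding c_def by (simp only:)
qed (simp add: legendre_coeff_def)

section \<open>Congruences for second-order harmonic sums\<close>

text \<open>Splits by parity and matches each even index with its reflection in
  \<open>2h + 1\<close>; \<open>sum_reflect\<close> instead folds the upper half onto the lower.
  Comparing the two evaluates the harmonic sums below.\<close>

lemma sum_pairs: "(\<Sum>i = 1..2 * h. f i) = (\<Sum>j = 1..(h::nat). f (2 * j) + f (2 * h + 1 - 2 * j) :: rat)"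
proof -
  have "(\<Sum>i = 1..2 * h. f i) = (\<Sum>j = 1..(h::nat). f (2 * j)) + (\<Sum>j = 1..h. f (2 * j - 1))"
    by (induction h) (simp_all add: algebra_simps)
  also have "(\<Sum>j = 1..h. f (2 * j - 1)) = (\<Sum>j = 1..h. f (2 * h + 1 - 2 * j))"
    by (rule sum.reindex_bij_witness[of _ "\<lambda>j. h + 1 - j" "\<lambda>j. h + 1 - j"])
      (auto intro!: arg_cong[of _ _ f])
  finally show ?thesis by (simp add: sum.distrib)
qed

lemma sum_reflect: "(\<Sum>i = 1..2 * h. f i) = (\<Sum>j = 1..(h::nat). f j + f (2 * h + 1 - j) :: rat)"
proof -
  have "{1..2 * h} = {1..h} \<union> {h + 1..2 * h}" by auto
  then have "(\<Sum>i = 1..2 * h. f i) = (\<Sum>j = 1..(h::nat). f j) + (\<Sum>j = h + 1..2 * h. f j)"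
    by (simp add: sum.union_disjoint)
  also have "(\<Sum>j = h + 1..2 * h. f j) = (\<Sum>j = 1..h. f (2 * h + 1 - j))"
    by (rule sum.reindex_bij_witness[of _ "\<lambda>j. 2 * h + 1 - j" "\<lambda>j. 2 * h + 1 - j"]) auto
  finally show ?thesis by (simp add: sum.distrib)
qed

lemma sum_alternating:
  "(\<Sum>j = 1..h. (- 1) ^ j * f j) = 2 * (\<Sum>j = 1..h div 2. f (2 * j)) - (\<Sum>j = 1..h. f j :: rat)"
proof (induction h)
  case (Suc h)
  show ?case
  proof (cases "even h")
    case True
    then have "Suc h div 2 = h div 2" by presburger
    with Suc True show ?thesis by simp
  next
    case False
    then have "Suc h div 2 = Suc (h div 2)" "2 * Suc (h div 2) = Suc h" by presburger+
    with Suc False show ?thesis by (simp add: algebra_simps)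
  qed
qed simp

context rat_localization
begin

text \<open>The difference has numerator \<open>(j - i)(j + i)\<close>, and
  \<open>j + i = p\<close>.\<close>

lemma inverse_sq_reflect:
  assumes "i + j = p" "0 < i" "0 < j"
  shows "pcong 1 (1 / of_nat i ^ 2) (1 / of_nat j ^ 2)"
proof -
  have "\<not> p dvd i" "\<not> p dvd j" using assms not_dvd_less[of i] not_dvd_less[of j] by linarith+
  then have "p_integral p ((of_nat j - of_nat i) * (1 / of_nat i ^ 2) * (1 / of_nat j ^ 2))"
    by (intro p_integral_mult p_integral_diff p_integral_inverse_sq) auto
  moreover have "1 / of_nat i ^ 2 = 1 / of_nat j ^ 2
      + of_nat p ^ 1 * ((of_nat j - of_nat i) * (1 / of_nat i ^ 2) * (1 / of_nat j ^ 2) :: rat)"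
    using assms by (simp add: field_simps power2_eq_square flip: assms(1))
  ultimately show ?thesis unfolding pcong_iff by blast
qed

text \<open>Folding the full sum gives \<open>2H\<close>, while pairing \<open>2j\<close> with
  \<open>p - 2j\<close> gives \<open>H/2\<close>. Hence \<open>(3/2) H\<close> vanishes modulo
  \<open>p\<close>, and \<open>p > 3\<close> permits multiplication by \<open>2/3\<close>.\<close>

lemma harmonic2_half:
  assumes "p = 2 * h + 1" "p > 3"
  shows "pcong 1 (\<Sum>j = 1..h. 1 / of_nat j ^ 2) 0"
    and "pcong 1 (\<Sum>j = 1..p - 1. 1 / of_nat j ^ 2) 0"
proof -
  define H where "H = (\<Sum>j = 1..h. 1 / (of_nat j :: rat) ^ 2)"
  have r: "pcong 1 (1 / of_nat j ^ 2 + 1 / of_nat (2 * h + 1 - j) ^ 2) (2 * (1 / of_nat j ^ 2))"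
    if "0 < j" "j \<le> 2 * h" for j
    using pcong_add[OF pcong_refl inverse_sq_reflect[of "2 * h + 1 - j" j], of "1 / of_nat j ^ 2"] that assms by simp
  have "pcong 1 (\<Sum>j = 1..2 * h. 1 / of_nat j ^ 2) (\<Sum>j = 1..h. 2 * (1 / of_nat j ^ 2))"
    unfolding sum_reflect by (intro pcong_sum r) auto
  then have 1: "pcong 1 (\<Sum>j = 1..2 * h. 1 / of_nat j ^ 2) (2 * H)"
    unfolding H_def sum_distrib_left .
  have "pcong 1 (\<Sum>j = 1..2 * h. 1 / of_nat j ^ 2) (\<Sum>j = 1..h. 2 * (1 / of_nat (2 * j) ^ 2))"
    unfolding sum_pairs by (intro pcong_sum r) auto
  also have "(\<Sum>j = 1..h. 2 * (1 / of_nat (2 * j) ^ 2)) = H / 2"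
    unfolding H_def by (simp add: sum_divide_distrib power_mult_distrib mult.commute)
  finally have "pcong 1 (2 * H) (H / 2)"
    using 1 pcong_trans pcong_sym by blast
  then have "pcong 1 (2 * H - H / 2) 0"
    using pcong_iff_0 by blast
  then have "pcong 1 (2 / 3 * (2 * H - H / 2)) (2 / 3 * 0)"
    using assms(2) by (intro pcong_cmult p_integral_divide_numeral p_integral_numeral)
  then have H: "pcong 1 H 0" by (simp add: algebra_simps)
  then show "pcong 1 (\<Sum>j = 1..h. 1 / of_nat j ^ 2) 0" by (simp add: H_def)
  have "pcong 1 (2 * H) (2 * 0)" using H by (intro pcong_cmult) auto
  then show "pcong 1 (\<Sum>j = 1..p - 1. 1 / of_nat j ^ 2) 0"
    using pcong_trans[OF 1] assms(1) by simp
qed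

lemma fermat_inverse_sq:
  assumes "p > 3" "\<not> p dvd i"
  shows "pcong 1 (of_nat i ^ (p - 3)) (1 / of_nat i ^ 2)"
proof -
  have "[int i ^ (p - 1) = 1] (mod int p)"
    using fermat_theorem[OF prime_p assms(2)] by (metis cong_int_iff of_nat_1 of_nat_power)
  then have "pcong 1 (of_nat i ^ (p - 1)) 1"
    using pcong_of_int by fastforce
  then have "pcong 1 (1 / of_nat i ^ 2 * of_nat i ^ (p - 1)) (1 / of_nat i ^ 2 * 1)"
    using assms by (intro pcong_cmult p_integral_inverse_sq)
  moreover have "(of_nat i :: rat) ^ (p - 1) = of_nat i ^ (p - 3) * of_nat i ^ 2"
    using assms(1) by (subst power_add[symmetric]) (simp add: numeral_eq_Suc Suc_diff_Suc)
  moreover have "i \<noteq> 0" using assms by (auto intro: Nat.gr0I)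
  ultimately show ?thesis by simp
qed

text \<open>In the alternating sum for the Euler number, the odd base \<open>2l + 1\<close> is
  \<open>p - 2j\<close> with \<open>j = h - l\<close>, and Fermat turns its power into
  \<open>1/(2j)^2\<close>. The resulting alternating harmonic sum reduces to the even
  \<open>j\<close>, because the complete half sum vanishes modulo \<open>p\<close>.\<close>

lemma harmonic2_quarter_euler:
  assumes "p = 2 * h + 1" "p > 3"
  shows "pcong 1 (\<Sum>j = 1..h div 2. 1 / of_nat j ^ 2) (4 * (- 1) ^ h * of_int (euler_number (p - 3)))"
proof -
  let ?E = "of_int (euler_number (p - 3)) :: rat"
  define H where "H = (\<Sum>j = 1..h. 1 / (of_nat j :: rat) ^ 2)"
  define H' where "H' = (\<Sum>j = 1..h div 2. 1 / (of_nat j :: rat) ^ 2)"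
  have "[euler_number (p - 3) = 2 * (\<Sum>l<h. (- 1) ^ l * (2 * int l + 1) ^ (p - 3))] (mod int p)"
    using euler_number_cong_alternating[of "p - 3" h] assms by (simp add: add.commute)
  then have "pcong 1 ?E (of_int (2 * (\<Sum>l<h. (- 1) ^ l * (2 * int l + 1) ^ (p - 3))))"
    by (rule pcong_of_int)
  also have "of_int (2 * (\<Sum>l<h. (- 1) ^ l * (2 * int l + 1) ^ (p - 3)))
      = 2 * (\<Sum>l<h. (- 1) ^ l * (of_nat (2 * l + 1) ^ (p - 3) :: rat))"
    by (simp add: add.commute)
  also have "(\<Sum>l<h. (- 1) ^ l * of_nat (2 * l + 1) ^ (p - 3) :: rat)
      = (\<Sum>j = 1..h. (- 1) ^ (h + j) * of_nat (p - 2 * j) ^ (p - 3))"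
  proof (rule sum.reindex_bij_witness[of _ "\<lambda>j. h - j" "\<lambda>l. h - l"])
    fix l assume l: "l \<in> {..<h}"
    then have "2 * l + 1 = p - 2 * (h - l)" "even (l + (h + (h - l)))" using assms by auto
    then show "(- 1) ^ (h + (h - l)) * of_nat (p - 2 * (h - l)) ^ (p - 3)
        = (- 1) ^ l * (of_nat (2 * l + 1) ^ (p - 3) :: rat)"
      by (metis even_add neg_one_even_power neg_one_odd_power)
  qed auto
  also have "pcong 1 (2 * \<dots>) (2 * (\<Sum>j = 1..h. (- 1) ^ (h + j) * (1 / of_nat (2 * j) ^ 2)))"
  proof (intro pcong_cmult pcong_sum)
    fix j assume j: "j \<in> {1..h}"
    then have d: "\<not> p dvd (p - 2 * j)" using assms by (intro not_dvd_less) auto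
    show "pcong 1 (of_nat (p - 2 * j) ^ (p - 3)) (1 / of_nat (2 * j) ^ 2)"
      using pcong_trans[OF fermat_inverse_sq[OF assms(2) d] inverse_sq_reflect[of _ "2 * j"]] j assms
      by simp
  qed (simp_all add: p_integral_power)
  also have "2 * (\<Sum>j = 1..h. (- 1) ^ (h + j) * (1 / of_nat (2 * j) ^ 2))
      = (- 1) ^ h / 2 * (\<Sum>j = 1..h. (- 1) ^ j * (1 / (of_nat j :: rat) ^ 2))"
    unfolding sum_distrib_left
    by (intro sum.cong) (simp_all add: power_add power_mult_distrib)
  \<comment> \<open>The even indices \<open>j = 2i\<close> contribute \<open>1/(4 i^2)\<close>,
    doubled by \<open>sum_alternating\<close>.\<close>
  also have "(\<Sum>j = 1..h. (- 1) ^ j * (1 / (of_nat j :: rat) ^ 2)) = H' / 2 - H"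
    unfolding sum_alternating H_def H'_def
    by (simp add: sum_divide_distrib sum_distrib_left power_mult_distrib mult.commute)
  finally have "pcong 1 ?E ((- 1) ^ h / 2 * (H' / 2 - H))" .
  then have "pcong 1 (4 * (- 1) ^ h * ?E) (4 * (- 1) ^ h * ((- 1) ^ h / 2 * (H' / 2 - H)))"
    by (intro pcong_cmult p_integral_intros) auto
  also have "4 * (- 1) ^ h * ((- 1) ^ h / 2 * (H' / 2 - H)) = H' + (- 2) * H"
    by (cases "even h") (auto simp: algebra_simps)
  also have "pcong 1 \<dots> (H' + (- 2) * 0)"
    using harmonic2_half(1)[OF assms] unfolding H_def[symmetric]
    by (intro pcong_add pcong_cmult) (auto intro: p_integral_uminus)
  finally show ?thesis
    unfolding H'_def by (simp add: pcong_sym)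
qed

end

section \<open>Congruences modulo the cube of a prime\<close>

text \<open>A case of Lucas' theorem: in Vandermonde's convolution for \<open>p + (pr + i)\<close>,
  every term with \<open>0 < k < p\<close> is divisible by \<open>p\<close>, so each step in
  \<open>r\<close> adds 1.\<close>

lemma choose_prime_cong:
  fixes p :: nat
  assumes "prime p" "i < p"
  shows "[(p * r + i) choose p = r] (mod p)"
proof (induction r)
  case 0
  then show ?case using assms by (simp add: binomial_eq_0)
next
  case (Suc r)
  have p0: "p > 0" using assms prime_gt_0_nat by blast
  have "((p * Suc r + i) choose p) = (\<Sum>k\<le>p. (p choose k) * ((p * r + i) choose (p - k)))"
    using vandermonde[of p "p * r + i" p] by (simp add: algebra_simps)
  also have "[\<dots> = (\<Sum>k\<le>p. (if k = 0 then (p * r + i) choose p else 0) + (if k = p then 1 else 0))] (mod p)"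
  proof (rule cong_sum)
    fix k assume "k \<in> {..p}"
    then consider "k = 0" | "k = p" | "0 < k" "k < p" by fastforce
    then show "[(p choose k) * ((p * r + i) choose (p - k))
        = (if k = 0 then (p * r + i) choose p else 0) + (if k = p then 1 else 0)] (mod p)"
    proof cases
      case 3
      then show ?thesis using dvd_choose_prime[of k p] assms by (simp add: cong_0_iff)
    qed (use p0 in auto)
  qed
  also have "(\<Sum>k\<le>p. (if k = 0 then (p * r + i) choose p else 0) + (if k = p then 1 else 0))
      = ((p * r + i) choose p) + 1"
    by (simp add: sum.distrib)
  also have "[\<dots> = r + 1] (mod p)"
    using Suc by (intro cong_add cong_refl)
  finally show ?case by simp
qed

context rat_localization
begin

lemma sine_prod_multiple:
  assumes "p > 3"
  shows "pcong 3 (sine_prod (p - 1) (of_nat (p * r))) 1"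
proof -
  \<comment> \<open>Products of two or more of the terms \<open>p^2 * x j\<close> are divisible by
    \<open>p^4\<close>, so only the linear part remains; it vanishes by
    \<open>harmonic2_half\<close>.\<close>
  have expand: "pcong 3 (\<Prod>j\<in>S. 1 - of_nat p ^ 2 * x j) (1 - of_nat p ^ 2 * sum x S)"
    if "finite S" "\<And>j. j \<in> S \<Longrightarrow> p_integral p (x j)" for S :: "nat set" and x
    using that
  proof (induction S rule: finite_induct)
    case (insert i S)
    have "pcong 3 (\<Prod>j\<in>insert i S. 1 - of_nat p ^ 2 * x j)
        ((1 - of_nat p ^ 2 * x i) * (1 - of_nat p ^ 2 * sum x S))"
      using insert by (simp, intro pcong_cmult p_integral_intros) auto
    also have "(1 - of_nat p ^ 2 * x i) * (1 - of_nat p ^ 2 * sum x S)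
        = (1 - of_nat p ^ 2 * sum x (insert i S)) + of_nat p ^ 3 * (of_nat p * x i * sum x S)"
      using insert by (simp add: algebra_simps power2_eq_square power3_eq_cube)
    also have "pcong 3 \<dots> (1 - of_nat p ^ 2 * sum x (insert i S))"
      unfolding pcong_iff
      by (intro exI[of _ "of_nat p * x i * sum x S"]) (use insert in \<open>auto intro!: p_integral_intros\<close>)
    finally show ?case .
  qed simp
  define x where "x j = of_nat r ^ 2 * (1 / (of_nat j :: rat) ^ 2)" for j
  have "sine_prod (p - 1) (of_nat (p * r)) = (\<Prod>j = 1..p - 1. 1 - of_nat p ^ 2 * x j)"
    unfolding sine_prod_def x_def by (intro prod.cong) (auto simp: field_simps)
  also have "pcong 3 \<dots> (1 - of_nat p ^ 2 * sum x {1..p - 1})"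
    unfolding x_def
    by (intro expand p_integral_mult p_integral_inverse_sq not_dvd_less) (auto intro: p_integral_power)
  also have "1 - of_nat p ^ 2 * sum x {1..p - 1} = 1 + (- 1) * (of_nat p ^ 2 * sum x {1..p - 1})"
    by simp
  also have "pcong 3 \<dots> (1 + (- 1) * (of_nat p ^ 2 * 0))"
  proof -
    have "odd p" using assms prime_p prime_odd_nat by auto
    then obtain h where "p = 2 * h + 1" by (auto elim: oddE)
    then have "pcong 1 (\<Sum>j = 1..p - 1. 1 / of_nat j ^ 2) 0"
      using harmonic2_half(2) assms by blast
    then have "pcong 1 (of_nat r ^ 2 * (\<Sum>j = 1..p - 1. 1 / of_nat j ^ 2)) (of_nat r ^ 2 * 0)"
      by (intro pcong_cmult p_integral_power) auto
    then have "pcong 1 (sum x {1..p - 1}) 0"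
      by (simp add: x_def sum_distrib_left)
    then have "pcong (2 + 1) (of_nat p ^ 2 * sum x {1..p - 1}) (of_nat p ^ 2 * 0)"
      by (rule pcong_shift)
    then have "pcong 3 (of_nat p ^ 2 * sum x {1..p - 1}) (of_nat p ^ 2 * 0)"
      by (simp only: numeral_plus_one add_num_simps)
    then show ?thesis
      by (intro pcong_add pcong_refl) (rule pcong_cmult, simp_all)
  qed
  finally show ?thesis by simp
qed

text \<open>Once \<open>sine_prod_binomial\<close> has split off \<open>p^2\<close>, working modulo
  \<open>p\<close> is enough: the binomials become \<open>r\<close> and \<open>r + 1\<close>, and
  the denominator \<open>b(b+p)\<close> becomes \<open>i^2\<close>.\<close>

lemma sine_prod_nonmultiple:
  assumes "p > 3" "0 < i" "i < p"
  shows "pcong 3 (sine_prod (p - 1) (of_nat (p * r + i)))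
    (of_nat p ^ 2 * (of_nat r * of_nat (r + 1) * (1 / of_nat i ^ 2)))"
proof -
  define b where "b = p * r + i"
  have odd: "odd p" using assms prime_p prime_odd_nat by auto
  have "b > 0" using assms by (simp add: b_def)
  then have nz: "of_nat b * of_nat (b + p) \<noteq> (0 :: rat)" by simp
  have "of_nat b * of_nat (b + p) * sine_prod (p - 1) (of_nat b)
      = of_nat p ^ 2 * of_nat (b choose p) * of_nat ((b + p) choose p)"
    using sine_prod_binomial[of b "p - 1"] odd assms by simp
  then have eq: "sine_prod (p - 1) (of_nat b)
      = of_nat p ^ 2 * (of_nat ((b choose p) * ((b + p) choose p)) / of_nat (b * (b + p)))"
    using nz by (simp add: field_simps)
  have bp: "b + p = p * (r + 1) + i" by (simp add: b_def)
  have "[(b choose p) * ((b + p) choose p) = r * (r + 1)] (mod p)"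
    unfolding bp unfolding b_def using assms prime_p by (intro cong_mult choose_prime_cong)
  then have "[int ((b choose p) * ((b + p) choose p)) = int (r * (r + 1))] (mod int p)"
    by (simp only: cong_int_iff)
  from pcong_of_int[OF this]
  have num: "pcong 1 (of_nat ((b choose p) * ((b + p) choose p))) (of_nat (r * (r + 1)))"
    by simp
  have "[b * (b + p) = i * i] (mod p)"
    by (intro cong_mult) (simp_all add: b_def cong_def)
  moreover have "\<not> p dvd i * i"
    using not_dvd_less assms prime_p by (simp add: prime_dvd_mult_iff)
  ultimately have "pcong 1 (of_nat ((b choose p) * ((b + p) choose p)) / of_nat (b * (b + p)))
      (of_nat (r * (r + 1)) / of_nat (i * i))"
    by (rule pcong_divide_nat[OF num p_integral_of_nat])
  then have "pcong (2 + 1) (sine_prod (p - 1) (of_nat b))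
      (of_nat p ^ 2 * (of_nat (r * (r + 1)) / of_nat (i * i)))"
    unfolding eq by (rule pcong_shift)
  then show ?thesis
    by (simp add: b_def power2_eq_square distrib_left)
qed

lemma sum_sine_prod_block:
  assumes "p > 3" "t < p"
  shows "pcong 3 (\<Sum>i\<le>t. sine_prod (p - 1) (of_nat (p * r + i)))
    (1 + of_nat p ^ 2 * (of_nat r * of_nat (r + 1) * (\<Sum>i = 1..t. 1 / of_nat i ^ 2)))"
proof -
  have "{..t} = insert 0 {1..t}" by auto
  then have "(\<Sum>i\<le>t. sine_prod (p - 1) (of_nat (p * r + i)))
      = sine_prod (p - 1) (of_nat (p * r)) + (\<Sum>i = 1..t. sine_prod (p - 1) (of_nat (p * r + i)))"
    by simp
  also have "pcong 3 \<dots> (1 + (\<Sum>i = 1..t. of_nat p ^ 2 * (of_nat r * of_nat (r + 1) * (1 / of_nat i ^ 2))))"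
    using assms by (intro pcong_add sine_prod_multiple pcong_sum sine_prod_nonmultiple) auto
  finally show ?thesis by (simp only: sum_distrib_left)
qed

text \<open>Each of the \<open>q + 1\<close> multiples of \<open>p\<close> contributes 1. Complete
  blocks add nothing more, so the harmonic term comes from the last block, where
  \<open>r = q\<close>. The induction takes \<open>t = p - 1\<close> for the preceding
  blocks.\<close>

lemma sum_sine_prod:
  assumes "p > 3" "t < p"
  shows "pcong 3 (\<Sum>b\<le>p * q + t. sine_prod (p - 1) (of_nat b))
    (of_nat (q + 1) + of_nat p ^ 2 * (of_nat q * of_nat (q + 1) * (\<Sum>i = 1..t. 1 / of_nat i ^ 2)))"
  using assms(2)
proof (induction q arbitrary: t)
  case 0
  then show ?case using sum_sine_prod_block[OF assms(1) 0, of 0] by simp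
next
  case (Suc q)
  let ?w = "\<lambda>b. sine_prod (p - 1) (of_nat b)"
  define H where "H t = (\<Sum>i = 1..t. 1 / (of_nat i :: rat) ^ 2)" for t
  have "{..p * Suc q + t} = {..p * q + (p - 1)} \<union> (\<lambda>i. p * Suc q + i) ` {..t}"
  proof (intro equalityI subsetI)
    fix x assume "x \<in> {..p * Suc q + t}"
    then show "x \<in> {..p * q + (p - 1)} \<union> (\<lambda>i. p * Suc q + i) ` {..t}"
      by (cases "x \<le> p * q + (p - 1)") (auto intro!: image_eqI[of _ _ "x - p * Suc q"])
  qed auto
  then have "sum ?w {..p * Suc q + t} = sum ?w {..p * q + (p - 1)} + sum ?w ((\<lambda>i. p * Suc q + i) ` {..t})"
    by (simp only:) (intro sum.union_disjoint, use assms in auto)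
  also have "sum ?w ((\<lambda>i. p * Suc q + i) ` {..t}) = (\<Sum>i\<le>t. ?w (p * Suc q + i))"
    by (subst sum.reindex) (auto simp: inj_on_def)
  also have "pcong 3 (sum ?w {..p * q + (p - 1)} + (\<Sum>i\<le>t. ?w (p * Suc q + i)))
      (of_nat (q + 1) + of_nat p ^ 2 * (of_nat q * of_nat (q + 1) * H (p - 1))
        + (1 + of_nat p ^ 2 * (of_nat (Suc q) * of_nat (Suc q + 1) * H t)))"
    unfolding H_def using assms Suc.prems by (intro pcong_add Suc.IH sum_sine_prod_block) auto
  also have "pcong 3 \<dots> (of_nat (q + 1) + of_nat p ^ 2 * (of_nat q * of_nat (q + 1) * 0)
        + (1 + of_nat p ^ 2 * (of_nat (Suc q) * of_nat (Suc q + 1) * H t)))"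
  proof -
    have "odd p" using assms prime_p prime_odd_nat by auto
    then obtain h where "p = 2 * h + 1" by (auto elim: oddE)
    then have "pcong 1 (H (p - 1)) 0"
      unfolding H_def using harmonic2_half(2) assms by blast
    then have "pcong (2 + 1) (of_nat p ^ 2 * (of_nat q * of_nat (q + 1) * H (p - 1)))
        (of_nat p ^ 2 * (of_nat q * of_nat (q + 1) * 0))"
      by (intro pcong_shift pcong_cmult p_integral_mult p_integral_of_nat)
    then show ?thesis by (intro pcong_add pcong_refl) simp
  qed
  finally show ?case by (simp add: H_def add.assoc)
qed

section \<open>Dependence of the sum on its argument modulo powers of \<open>p\<close>\<close>

lemma legendre_coeff_pcong:
  assumes "pcong m y z" "p_integral p z" "k < p"
  shows "pcong m (legendre_coeff y k) (legendre_coeff z k) \<and> p_integral p (legendre_coeff z k)"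
  using assms(3)
proof (induction k)
  case (Suc k)
  define f where "f z = (1 / of_nat (Suc k) ^ 2) * (of_nat (Suc k) * of_nat k + (- 1) * z)" for z :: rat
  have rec: "legendre_coeff z (Suc k) = legendre_coeff z k * f z" for z
    by (simp add: legendre_coeff_def f_def)
  \<comment> \<open>The bound \<open>k < p\<close> keeps every denominator prime to
    \<open>p\<close>.\<close>
  have inv: "p_integral p (1 / of_nat (Suc k) ^ 2)"
    using Suc.prems by (intro p_integral_inverse_sq not_dvd_less) auto
  have y: "p_integral p y" using pcong_p_integral assms by blast
  have "pcong m (f y) (f z)"
    unfolding f_def
    by (intro pcong_cmult[OF _ inv] pcong_add pcong_refl pcong_cmult assms) (auto intro: p_integral_uminus)
  moreover have "p_integral p (f z)" if "p_integral p z" for z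
    unfolding f_def using that by (intro p_integral_intros inv) (auto intro: p_integral_uminus)
  ultimately show ?case
    using Suc assms y unfolding rec by (auto intro!: pcong_mult p_integral_mult)
qed (simp add: legendre_coeff_def)

lemma legendre_sum_pcong:
  assumes "pcong 5 y z" "p_integral p z"
  shows "pcong 3 (legendre_sum p y) (legendre_sum p z)"
  unfolding legendre_sum_def
proof (rule pcong_sum)
  fix k assume k: "k \<in> {..<p}"
  define n where "n = 2 * k + 1"
  obtain c where c: "p_integral p c" "legendre_coeff y k = legendre_coeff z k + of_nat p ^ 5 * c"
    using legendre_coeff_pcong[OF assms, of k] k unfolding pcong_iff by auto
  have "p_integral p (of_nat p ^ 2 * c / of_nat n)"
  proof (cases "p dvd n")
    case False
    then show ?thesis using c by (intro p_integral_intros) auto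
  next
    case True
    then obtain d where d: "n = p * d" by blast
    \<comment> \<open>As \<open>2k + 1 < 2p\<close>, the only multiple of \<open>p\<close> among
      these denominators is \<open>p\<close> itself, so the division costs a single factor
      \<open>p\<close>.\<close>
    have "p * d < p * 2" using k unfolding d[symmetric] n_def by auto
    moreover have "n > 0" by (simp add: n_def)
    ultimately have "d = 1" unfolding d by simp
    then have "of_nat p ^ 2 * c / of_nat n = of_nat p * c"
      using d by (simp add: power2_eq_square)
    then show ?thesis using c by (auto intro: p_integral_mult)
  qed
  moreover have "legendre_coeff y k / of_nat n
      = legendre_coeff z k / of_nat n + of_nat p ^ 3 * (of_nat p ^ 2 * c / of_nat n)"
    unfolding c(2) by (simp add: add_divide_distrib mult.assoc flip: power_add)
  ultimately show "pcong 3 (legendre_coeff y k / of_nat (2 * k + 1)) (legendre_coeff z k / of_nat (2 * k + 1))"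
    unfolding pcong_iff n_def by blast
qed

end

section \<open>Evaluation at a natural number approximating \<open>-1/4\<close> and assembly of the
  congruence\<close>

theorem theorem3p2:
  fixes p :: nat
  assumes "prime p" and "p > 3"
  shows "rat_cong p 3
    (\<Sum>k = 0..p - 1. of_nat ((2 * k) choose k) * of_nat ((4 * k) choose (2 * k))
        / (64 ^ k * of_nat (2 * k + 1)))
    ((- 1) ^ ((p - 1) div 2) - 3 * of_nat p ^ 2 * of_int (euler_number (p - 3)))"
proof -
  interpret rat_localization p by standard (fact assms(1))
  have "odd p" using assms prime_odd_nat by auto
  then obtain h where h: "p = 2 * h + 1" by (auto elim: oddE)
  define P where "P = (of_nat p :: rat)"
  define \<epsilon> where "\<epsilon> = ((- 1) ^ h :: rat)"
  define E where "E = (of_int (euler_number (p - 3)) :: rat)"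
  define t where "t = h div 2"
  define q where "q = (p ^ 4 - 1) div 4"
  define m where "m = p * q + t"
  define H where "H = (\<Sum>i = 1..t. 1 / (of_nat i :: rat) ^ 2)"
  define S where "S = (\<Sum>b\<le>m. sine_prod (p - 1) (of_nat b))"
  define F where "F = legendre_sum p (of_nat m * (of_nat m + 1))"
  have eps: "\<epsilon> * \<epsilon> = 1" "p_integral p \<epsilon>"
    by (cases "even h", auto simp: \<epsilon>_def)
  \<comment> \<open>If \<open>h\<close> is even then \<open>p = 4t + 1\<close>, otherwise
    \<open>p = 4t + 3\<close>; \<open>\<epsilon>\<close> records which.\<close>
  have t: "4 * of_nat t = P - 2 + \<epsilon>"
    unfolding t_def \<epsilon>_def P_def h by (cases "even h") (auto elim!: evenE oddE)
  have q: "4 * of_nat q = P ^ 4 - 1"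
  proof -
    have "[p ^ 2 * p ^ 2 = 1 * 1] (mod 4)"
      using h by (intro cong_mult) (simp_all add: cong_def power2_eq_square mod_Suc algebra_simps)
    then have "4 dvd p ^ 4 - 1"
      using cong_altdef_nat by (metis cong_sym_eq cong_to_1_nat mult_1 power_add numeral_Bit0)
    then have "4 * q = p ^ 4 - 1" by (simp add: q_def)
    then have "4 * q + 1 = p ^ 4" using assms(2) by simp
    then have "of_nat (4 * q + 1) = P ^ 4" unfolding P_def by (metis of_nat_power)
    then show ?thesis by (simp add: eq_diff_eq)
  qed
  have m2: "2 * of_nat m + 1 = (P ^ 5 + \<epsilon>) / 2"
  proof -
    have "4 * of_nat m = P * (4 * of_nat q) + 4 * of_nat t"
      by (simp add: m_def P_def algebra_simps)
    also have "\<dots> = P ^ 5 - 2 + \<epsilon>"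
      unfolding q t by (simp add: algebra_simps eval_nat_numeral)
    finally show ?thesis by (simp add: field_simps)
  qed
  \<comment> \<open>Completing the square, \<open>4m(m+1) = (2m+1)^2 - 1\<close>, together with
    \<open>\<epsilon>^2 = 1\<close>.\<close>
  have z: "of_nat m * (of_nat m + 1) = - 3 / 16 + P ^ 5 * ((P ^ 5 + 2 * \<epsilon>) / 16)"
  proof -
    have "4 * (of_nat m * (of_nat m + 1)) = (2 * of_nat m + 1) ^ 2 - (1 :: rat)"
      by (simp add: power2_eq_square algebra_simps)
    also have "\<dots> = (P ^ 5 * P ^ 5 + 2 * \<epsilon> * P ^ 5 + \<epsilon> * \<epsilon>) / 4 - 1"
      unfolding m2 by (simp add: power2_eq_square algebra_simps add_divide_distrib)
    finally show ?thesis unfolding eps by (simp add: field_simps)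
  qed
  have div16: "p_integral p (x / 16)" if "p_integral p x" for x
  proof -
    have "\<not> p dvd 2 ^ 4" using assms prime_dvd_power[of p 2 4] nat_dvd_not_less[of 2 p] by auto
    then show ?thesis using p_integral_divide_nat[OF that, of "2 ^ 4"] by simp
  qed
  have "pcong 5 (of_nat m * (of_nat m + 1)) (- 3 / 16)"
    unfolding pcong_iff z P_def using eps
    by (intro exI[of _ "(of_nat p ^ 5 + 2 * \<epsilon>) / 16"] conjI div16 p_integral_intros) auto
  then have approx: "pcong 3 F (legendre_sum p (- 3 / 16))"
    unfolding F_def by (intro legendre_sum_pcong div16) (auto intro: p_integral_uminus)
  have "(P ^ 5 + \<epsilon>) * F = 4 * S - 2"
    using legendre_sum_nat[of m "p - 1"] assms(2)
    unfolding m2 F_def S_def by (simp add: field_simps)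
  then have F: "F * (P ^ 5 + \<epsilon>) = 4 * S - 2" by (simp add: mult.commute)
  have "t < p" unfolding t_def using h by linarith
  then have "pcong 3 S (of_nat (q + 1) + P ^ 2 * (of_nat q * of_nat (q + 1) * H))"
    unfolding S_def m_def H_def P_def using sum_sine_prod assms by blast
  then have "pcong 3 (4 * S) (4 * (of_nat (q + 1) + P ^ 2 * (of_nat q * of_nat (q + 1) * H)))"
    by (intro pcong_cmult) auto
  from pcong_add[OF this pcong_refl[of 3 "- 2"]]
  have "pcong 3 (4 * S - 2) (4 * of_nat q + 2 + 4 * (P ^ 2 * (of_nat q * of_nat (q + 1) * H)))"
    by (simp add: algebra_simps)
  also have "4 * of_nat q + 2 + 4 * (P ^ 2 * (of_nat q * of_nat (q + 1) * H))
     = 1 + P ^ 4 + P ^ 2 * (of_nat q * (4 * of_nat q + 4) * H)"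
    unfolding q[unfolded eq_diff_eq, symmetric] by (simp add: algebra_simps)
  also have "pcong 3 \<dots> (1 + 0 + P ^ 2 * (- 3 * \<epsilon> * E))"
  proof (intro pcong_add pcong_refl)
    show "pcong 3 (P ^ 4) 0"
      unfolding pcong_iff P_def by (intro exI[of _ "of_nat p"]) (simp add: eval_nat_numeral)
    have H: "pcong 1 H (4 * \<epsilon> * E)"
      unfolding H_def t_def \<epsilon>_def E_def by (rule harmonic2_quarter_euler[OF h assms(2)])
    have P4: "pcong 1 (P ^ 4) 0"
      unfolding pcong_iff P_def by (intro exI[of _ "of_nat p ^ 3"]) (auto simp: eval_nat_numeral intro!: p_integral_intros)
    have "pcong 1 (of_nat q * (4 * of_nat q + 4) * H) (of_nat q * (4 * of_nat q + 4) * (4 * \<epsilon> * E))"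
      by (intro pcong_cmult H p_integral_intros) auto
    \<comment> \<open>The constant \<open>-3\<close> arises here:
      \<open>4q (4q + 4) = (P^4 - 1)(P^4 + 3)\<close>, which is \<open>-3\<close> modulo
      \<open>p\<close>.\<close>
    also have "of_nat q * (4 * of_nat q + 4) * (4 * \<epsilon> * E) = \<epsilon> * E * (P ^ 4 + 2) * P ^ 4 + - 3 * \<epsilon> * E"
    proof -
      have "of_nat q * (4 * of_nat q + 4) * (4 * \<epsilon> * E) = (4 * of_nat q) * (4 * of_nat q + 4) * \<epsilon> * E"
        by simp
      also have "\<dots> = \<epsilon> * E * (P ^ 4 + 2) * P ^ 4 + - 3 * \<epsilon> * E"
        unfolding q by (simp add: algebra_simps)
      finally show ?thesis .
    qed
    also have "pcong 1 \<dots> (\<epsilon> * E * (P ^ 4 + 2) * 0 + - 3 * \<epsilon> * E)"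
      using eps unfolding E_def P_def
      by (intro pcong_add pcong_refl pcong_cmult P4[unfolded P_def] p_integral_intros) auto
    finally have "pcong 1 (of_nat q * (4 * of_nat q + 4) * H) (- 3 * \<epsilon> * E)" by simp
    from pcong_shift[OF this, of 2]
    show "pcong 3 (P ^ 2 * (of_nat q * (4 * of_nat q + 4) * H)) (P ^ 2 * (- 3 * \<epsilon> * E))"
      by (simp add: P_def)
  qed
  finally have S: "pcong 3 (F * (P ^ 5 + \<epsilon>)) (1 - 3 * P ^ 2 * \<epsilon> * E)"
    unfolding F by (simp add: mult_ac)
  \<comment> \<open>This number is \<open>1\<close> or \<open>-1\<close> modulo \<open>p\<close>,
    hence invertible in the localization.\<close>
  have unit: "P ^ 5 + \<epsilon> \<noteq> 0" "p_integral p (1 / (P ^ 5 + \<epsilon>))"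
  proof -
    define u where "u = int p ^ 5 + (- 1) ^ h"
    have u: "P ^ 5 + \<epsilon> = of_int u" by (simp add: u_def P_def \<epsilon>_def)
    have "gcd (int p) (int p ^ 4 * int p + (- 1) ^ h) = gcd (int p) ((- 1) ^ h)"
      by (rule gcd_add_mult)
    also have "\<dots> = 1" by (cases "even h") auto
    also have "int p ^ 4 * int p + (- 1) ^ h = u" by (simp add: u_def eval_nat_numeral)
    finally have "coprime u (int p)" by (simp add: coprime_iff_gcd_eq_1 gcd.commute)
    then show "p_integral p (1 / (P ^ 5 + \<epsilon>))"
      unfolding u p_integral_iff by (intro exI[of _ 1] exI[of _ u]) simp
    show "P ^ 5 + \<epsilon> \<noteq> 0"
      unfolding u using \<open>coprime u (int p)\<close> assms by auto
  qed
  have "pcong 3 (\<epsilon> * (F * (P ^ 5 + \<epsilon>))) (\<epsilon> * (1 - 3 * P ^ 2 * \<epsilon> * E))"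
    by (intro pcong_cmult S eps)
  also have "\<epsilon> * (1 - 3 * P ^ 2 * \<epsilon> * E) = \<epsilon> - 3 * P ^ 2 * (\<epsilon> * \<epsilon>) * E"
    by (simp only: algebra_simps mult_1_right)
  finally have main: "pcong 3 (\<epsilon> * (F * (P ^ 5 + \<epsilon>))) (\<epsilon> - 3 * P ^ 2 * E)"
    by (simp only: eps(1) mult_1_right)
  have int_rhs: "p_integral p (\<epsilon> - 3 * P ^ 2 * E)"
    using eps unfolding P_def E_def by (intro p_integral_intros) auto
  \<comment> \<open>Integrality of \<open>F\<close> is not visible termwise because of the
    denominator \<open>2k + 1 = p\<close>. It follows from the congruence to an integral value,
    after division by the unit.\<close>
  have "p_integral p (\<epsilon> * (F * (P ^ 5 + \<epsilon>)))"
    using main int_rhs by (rule pcong_p_integral)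
  then have "p_integral p ((1 / (P ^ 5 + \<epsilon>)) * \<epsilon> * (\<epsilon> * (F * (P ^ 5 + \<epsilon>))))"
    by (rule p_integral_mult[OF p_integral_mult[OF unit(2) eps(2)]])
  moreover have "(1 / (P ^ 5 + \<epsilon>)) * \<epsilon> * (\<epsilon> * (F * (P ^ 5 + \<epsilon>))) = \<epsilon> * \<epsilon> * F"
    using unit(1) by (simp add: field_simps)
  ultimately have intF: "p_integral p F" by (simp add: eps)
  \<comment> \<open>As \<open>\<epsilon>^2 = 1\<close>, the discrepancy is
    \<open>P^5 * \<epsilon> * F\<close>, negligible modulo \<open>p^3\<close> now that
    \<open>F\<close> is known to be integral.\<close>
  have "F = \<epsilon> * (F * (P ^ 5 + \<epsilon>)) + P ^ 3 * (- (P ^ 2 * \<epsilon> * F))"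
    using eps(1) by (simp add: algebra_simps eval_nat_numeral)
  then have "pcong 3 F (\<epsilon> * (F * (P ^ 5 + \<epsilon>)))"
    unfolding pcong_iff P_def using eps intF
    by (intro exI[of _ "- (of_nat p ^ 2 * \<epsilon> * F)"] conjI p_integral_intros) auto
  then have "pcong 3 (legendre_sum p (- 3 / 16)) (\<epsilon> - 3 * P ^ 2 * E)"
    using approx main pcong_trans pcong_sym by blast
  moreover have "legendre_sum p (- 3 / 16) = (\<Sum>k = 0..p - 1. of_nat ((2 * k) choose k)
      * of_nat ((4 * k) choose (2 * k)) / (64 ^ k * of_nat (2 * k + 1)))"
  proof -
    have "{..<p} = {0..p - 1}" using assms(2) by auto
    then show ?thesis
      unfolding legendre_sum_def legendre_coeff_central by (simp only: divide_divide_eq_left)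
  qed
  moreover have "(p - 1) div 2 = h" using h by simp
  ultimately show ?thesis
    using int_rhs pcong_p_integral unfolding rat_cong_def
    by (simp only: pcong_def P_def \<epsilon>_def E_def)
qed

end
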